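(* Let $f\in\mathbb{Z}[t_1^{\pm1},\dots,t_n^{\pm1}]$ be a Laurent polynomial with at least two terms (i.e. $\operatorname{supp}(f)$ has at least two elements), let $m$ be the dimension of its Newton polyhedron $N(f)$, and fix a coordinate system with $m$ essential variables for $f$. Then in the space $(\mathbb{R}^m)^*$ spanned by the essential variables the Laurent norm for $f$ is non-degenerate: for $\phi\in(\mathbb{R}^m)^*$, $\|\phi\|_f=0$ if and only if $\phi=0$.
   Context: For nonzero $f=\sum c_\alpha\mathbf{t}^\alpha\in\mathbb{Z}[t_1^{\pm1},\dots,t_n^{\pm1}]$, let $\operatorname{supp}(f)=\{\alpha\in\mathbb{Z}^n:c_\alpha\ne0\}$; the Newton polyhedron $N(f)$ is the convex hull of $\operatorname{supp}(f)$ in $\mathbb{R}^n$, and $m=\dim N(f)\le n$ is its (affine) dimension. The Laurent norm of $\phi\in(\mathbb{R}^n)^*$ is $\|\phi\|_f=\sup_{\alpha,\beta\in\operatorname{supp}(f)}\phi(\alpha-\beta)$. Essential variables: choose an affine coordinate system $(x_1,\dots,x_n)$ of $\mathbb{R}^n$ (i.e. an affine bijection $A:\mathbb{R}^n\to\mathbb{R}^n$) in which the last $n-m$ coordinates vanish identically on $N(f)$, i.e. $A(N(f))\subset\mathbb{R}^m\times\{0\}$. The set $\operatorname{supp}(f)$ and the polyhedron $N(f)$ are then expressed in these coordinates (replaced by their images under $A$), dual vectors are written $\phi=(\phi_1,\dots,\phi_n)$ with $\phi(x)=\sum_i\phi_ix_i$, and $\|\phi\|_f$ is given by the same formula using the exponents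 in these coordinates. The coordinates $(x_1,\dots,x_m)$, and dually $(\phi_1,\dots,\phi_m)$, are the essential variables; $(\mathbb{R}^m)^*$ is the subspace of dual vectors with $\phi_{m+1}=\dots=\phi_n=0$. *)

theory Defs
  imports "HOL-Analysis.Analysis" "HOL-Library.Poly_Mapping"
begin

text \<open>
  The Laurent polynomial ring in \<open>n = CARD('n)\<close> variables over the integers is the group ring of
  \<open>int ^ 'n\<close>, that is, the finitely supported functions with convolution as multiplication.
\<close>

type_synonym 'n laurent_poly = "(int ^ 'n) \<Rightarrow>\<^sub>0 int"

definition real_exponent :: "int ^ 'n \<Rightarrow> real ^ 'n"
  where "real_exponent \<alpha> = (\<chi> i. real_of_int (\<alpha> $ i))"

definition lsupp :: "('n::finite) laurent_poly \<Rightarrow> (real ^ 'n) set"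
  where "lsupp f = real_exponent ` Poly_Mapping.keys f"

definition newton_polyhedron :: "('n::finite) laurent_poly \<Rightarrow> (real ^ 'n) set"
  where "newton_polyhedron f = convex hull (lsupp f)"

text \<open>
  The Laurent norm takes the set \<open>S\<close> of exponents, not the polynomial, because the same formula is
  used with the exponents expressed in other affine coordinates. A dual vector is given by its
  coordinates and acts by \<open>\<phi> \<bullet> x = (\<Sum>i. \<phi> $ i * x $ i)\<close>.
\<close>

definition laurent_norm :: "(real ^ 'n) set \<Rightarrow> real ^ 'n \<Rightarrow> real"
  where "laurent_norm S \<phi> = (SUP (\<alpha>, \<beta>) \<in> S \<times> S. \<phi> \<bullet> (\<alpha> - \<beta>))"

definition affine_coordinates :: "(real ^ 'n \<Rightarrow> real ^ 'n) \<Rightarrow> bool"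
  where "affine_coordinates A \<longleftrightarrow> bij A \<and> (\<exists>L c. linear L \<and> (\<forall>x. A x = L x + c))"

text \<open>
  Vectors supported on the first \<open>m\<close> coordinates, in the order of the index type: those after the
  first \<open>m\<close> are the indices with at least \<open>m\<close> predecessors. This is both the subspace
  of points whose last \<open>n - m\<close> coordinates vanish and, for coordinates of dual vectors, the dual
  space of the essential variables.
\<close>

definition first_coords :: "nat \<Rightarrow> (real ^ 'n::{finite,linorder}) set"
  where "first_coords m = {x. \<forall>i. m \<le> card {j. j < i} \<longrightarrow> x $ i = 0}"

definition essential_coordinates ::
    "('n::{finite,linorder}) laurent_poly \<Rightarrow> nat \<Rightarrow>
      (real ^ 'n::{finite,linorder} \<Rightarrow> real ^ 'n::{finite,linorder}) \<Rightarrow> bool"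
  where "essential_coordinates f m A \<longleftrightarrow>
    affine_coordinates A \<and> A ` newton_polyhedron f \<subseteq> first_coords m"

end

theory Submission imports Defs begin

text \<open>
  The norm of \<open>\<phi>\<close> vanishes exactly if \<open>\<phi>\<close> is constant on the exponents. The exponents lie in the
  subspace of the essential variables and, by the choice of \<open>m\<close>, affinely span it; so a \<open>\<phi>\<close> that is
  constant on them is constant on the subspace, and hence orthogonal to it. As \<open>\<phi>\<close> itself lies in
  this subspace, it is zero.
\<close>

text \<open>Exchanging \<alpha> and \<beta> changes the sign of \<phi> \<bullet> (\<alpha> -
  \<beta>), so a supremum of 0 bounds the difference from both sides. Finiteness of \<open>S\<close>
  makes the supremum a genuine upper bound.\<close>

lemma laurent_norm_eq_0_iff:
  fixes S :: "(real ^ 'n) set"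
  assumes "finite S" "S \<noteq> {}"
  shows "laurent_norm S \<phi> = 0 \<longleftrightarrow> (\<forall>\<alpha>\<in>S. \<forall>\<beta>\<in>S. \<phi> \<bullet> \<alpha> = \<phi> \<bullet> \<beta>)"
proof
  assume norm: "laurent_norm S \<phi> = 0"
  have le: "\<phi> \<bullet> \<alpha> \<le> \<phi> \<bullet> \<beta>" if "\<alpha> \<in> S" "\<beta> \<in> S" for \<alpha> \<beta>
  proof -
    have "bdd_above ((\<lambda>(\<alpha>, \<beta>). \<phi> \<bullet> (\<alpha> - \<beta>)) ` (S \<times> S))"
      using assms by (intro bdd_above_finite) auto
    then have "(\<lambda>(\<alpha>, \<beta>). \<phi> \<bullet> (\<alpha> - \<beta>)) (\<alpha>, \<beta>) \<le> laurent_norm S \<phi>"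
      unfolding laurent_norm_def by (rule cSUP_upper[rotated]) (use that in auto)
    with norm show ?thesis by (simp add: inner_diff_right)
  qed
  then show "\<forall>\<alpha>\<in>S. \<forall>\<beta>\<in>S. \<phi> \<bullet> \<alpha> = \<phi> \<bullet> \<beta>"
    by (simp add: order_antisym)
next
  assume const: "\<forall>\<alpha>\<in>S. \<forall>\<beta>\<in>S. \<phi> \<bullet> \<alpha> = \<phi> \<bullet> \<beta>"
  have "\<phi> \<bullet> (\<alpha> - \<beta>) = 0" if "\<alpha> \<in> S" "\<beta> \<in> S" for \<alpha> \<beta>
    using const[rule_format, OF that] by (simp add: inner_diff_right)
  \<comment> \<open>As \<open>S\<close> is nonempty, the image is a singleton and not the empty set,
    whose supremum would say nothing.\<close>
  then have "(\<lambda>(\<alpha>, \<beta>). \<phi> \<bullet> (\<alpha> - \<beta>)) ` (S \<times> S) = {0}"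
    using assms(2) by (force simp: image_def)
  then show "laurent_norm S \<phi> = 0"
    by (simp add: laurent_norm_def)
qed

lemma aff_dim_affine_coordinates:
  assumes "affine_coordinates A"
  shows "aff_dim (A ` S) = aff_dim S"
proof -
  obtain L c where L: "linear L" and A: "\<And>x. A x = L x + c" and "inj A"
    using assms unfolding affine_coordinates_def by (blast dest: bij_is_inj)
  from \<open>inj A\<close> have "inj L"
    by (simp add: inj_def A)
  have "A ` S = (+) c ` L ` S"
    by (auto simp: A image_image add.commute)
  with L \<open>inj L\<close> show ?thesis
    by (simp add: aff_dim_translation_eq aff_dim_injective_linear_image)
qed

lemma subspace_first_coords: "subspace (first_coords m)"
  by (auto simp: first_coords_def subspace_def)

text \<open>Counting predecessors is strictly increasing in the index, so it embeds the indices of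
  the free coordinates into the numbers below \<open>m\<close>. Equality would fail for
  \<open>m\<close> larger than the number of indices.\<close>

lemma dim_first_coords_le: "dim (first_coords m :: (real ^ 'n::{finite,linorder}) set) \<le> m"
proof -
  let ?D = "{i::'n. card {j. j < i} < m}"
  have "first_coords m = {x :: real ^ 'n::{finite,linorder}. \<forall>i. i \<notin> ?D \<longrightarrow> x $ i = 0}"
    by (auto simp: first_coords_def not_less)
  then have "dim (first_coords m :: (real ^ 'n::{finite,linorder}) set) = card ?D"
    by (simp only: dim_substandard_cart flip: dim_vec_eq)
  also have "\<dots> \<le> card {..<m}"
  proof (rule card_inj_on_le)
    have "card {k. k < i} < card {k. k < j}" if "i < j" for i j :: 'n
      using that by (intro psubset_card_mono) auto
    then show "inj_on (\<lambda>i. card {j. j < i}) ?D"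
      by (intro linorder_inj_onI') (metis less_irrefl)
  qed auto
  finally show ?thesis by simp
qed

theorem theorem1p7:
  fixes f :: "('n::{finite,linorder}) laurent_poly"
    and m :: nat
    and A :: "real ^ 'n::{finite,linorder} \<Rightarrow> real ^ 'n::{finite,linorder}"
    and \<phi> :: "real ^ 'n::{finite,linorder}"
  assumes "card (Poly_Mapping.keys f) \<ge> 2"
    and "int m = aff_dim (newton_polyhedron f)"
    and "essential_coordinates f m A"
    and "\<phi> \<in> first_coords m"
  shows "laurent_norm (A ` lsupp f) \<phi> = 0 \<longleftrightarrow> \<phi> = 0"
proof -
  let ?T = "A ` lsupp f" and ?V = "first_coords m :: (real ^ 'n::{finite,linorder}) set"
  have "finite ?T" "?T \<noteq> {}"
    using assms(1) by (auto simp: lsupp_def)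
  have T: "?T \<subseteq> ?V"
    using assms(3) hull_subset[of "lsupp f" convex]
    by (auto simp: essential_coordinates_def newton_polyhedron_def)
  \<comment> \<open>Neither the change of coordinates nor passing to the convex hull alters the
    affine dimension.\<close>
  have "aff_dim ?T = int m"
    using assms(2,3)
    by (simp add: essential_coordinates_def aff_dim_affine_coordinates newton_polyhedron_def
        aff_dim_convex_hull)
  moreover have "aff_dim ?V \<le> int m"
    using dim_first_coords_le by (simp add: aff_dim_subspace subspace_first_coords)
  \<comment> \<open>The inclusion \<open>T\<close> squeezes the affine dimension of
    \<open>?V\<close> to \<open>m\<close> as well, and a subset of full affine dimension has the
    same affine hull.\<close>
  ultimately have "affine hull ?T = affine hull ?V"
    using T aff_dim_subset[OF T] aff_dim_eq_full_gen by (metis order_antisym)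
  then have span: "affine hull ?T = ?V"
    by (simp add: subspace_first_coords subspace_imp_affine)
  have "\<phi> = 0" if "\<forall>\<alpha>\<in>?T. \<forall>\<beta>\<in>?T. \<phi> \<bullet> \<alpha> = \<phi> \<bullet> \<beta>"
  proof -
    obtain \<beta> where "\<beta> \<in> ?T"
      using \<open>?T \<noteq> {}\<close> by blast
    define b where "b = \<phi> \<bullet> \<beta>"
    have "?T \<subseteq> {x. \<phi> \<bullet> x = b}"
      unfolding b_def using that \<open>\<beta> \<in> ?T\<close> by blast
    then have "?V \<subseteq> {x. \<phi> \<bullet> x = b}"
      unfolding span[symmetric] by (rule hull_minimal) (rule affine_hyperplane)
    \<comment> \<open>Two test points of \<open>?V\<close>: the origin forces \<open>b\<close> to be
      0, and \<phi> itself then has norm 0.\<close>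
    then have "\<phi> \<bullet> 0 = b" "\<phi> \<bullet> \<phi> = b"
      using assms(4) subspace_0[OF subspace_first_coords] by blast+
    then show ?thesis by simp
  qed
  then show ?thesis
    using laurent_norm_eq_0_iff[OF \<open>finite ?T\<close> \<open>?T \<noteq> {}\<close>] by auto
qed

end
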